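(* There is a constant $c>0$ such that for every $\varepsilon\in(0,1)$, for all $n$ sufficiently large, any $(1+\varepsilon)$-embedding of $U_n\subseteq\ell_1^n$ into $\ell_1^d$ requires $$d\ge\frac{c\log n}{\varepsilon\log\frac1\varepsilon}.$$
   Context: $\ell_1^d$ denotes $\mathbb R^d$ equipped with the $\ell_1$ norm. $U_n=\{e_1,\dots,e_n\}$, where $e_1,\dots,e_n$ are the standard basis vectors of $\mathbb R^n$, and $U_n$ carries the metric induced by the $\ell_1$ norm. For a map $f:X\to Y$ between metric spaces $(X,d_X)$ and $(Y,d_Y)$, $\|f\|_{\mathrm{Lip}}=\sup_{x\ne y\in X}\frac{d_Y(f(x),f(y))}{d_X(x,y)}$, and the bi-Lipschitz distortion of $f$ is $\|f\|_{\mathrm{Lip}}\cdot\|f^{-1}\|_{\mathrm{Lip}}$ (with $f^{-1}$ defined on $f(X)$), taken to be infinite if $f$ is not one-to-one. A $D$-embedding is a map with distortion at most $D$.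
   Formalization: The factor log(1/ε) in the bound is replaced by max(1, log(1/ε)): as printed the bound fails for ε near 1, since random binary vectors give a 3/2-embedding with d = O(log n); for ε ≤ 1/e the bound is unchanged. *)

theory Defs
  imports
    "HOL-Library.Extended_Nonnegative_Real"
    "HOL-Analysis.Abstract_Metric_Spaces"
    "Jordan_Normal_Form.Matrix"
begin

text \<open>
  Vectors of a dimension that is bound inside a formula: \<open>\<real>\<^sup>d\<close> is \<open>carrier_vec d\<close> and the
  standard basis vectors are \<open>unit_vec n i\<close> with \<open>i < n\<close> (indices start at 0).
\<close>

definition l1_dist :: "nat \<Rightarrow> real vec \<Rightarrow> real vec \<Rightarrow> real" where
  "l1_dist d u v = (\<Sum>i<d. \<bar>vec_index u i - vec_index v i\<bar>)"

definition U :: "nat \<Rightarrow> real vec set" where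
  "U n = unit_vec n ` {..<n}"

text \<open>
  Metric spaces are given by a carrier and a distance, as in the locale \<open>Metric_space\<close>.
  Suprema are taken in \<open>ennreal\<close>: an unbounded supremum is \<open>\<infinity>\<close> and the supremum over the empty
  set of pairs (at most one point) is 0.
\<close>

definition lip_norm ::
    "'a set \<Rightarrow> ('a \<Rightarrow> 'a \<Rightarrow> real) \<Rightarrow> ('b \<Rightarrow> 'b \<Rightarrow> real) \<Rightarrow> ('a \<Rightarrow> 'b) \<Rightarrow> ennreal" where
  "lip_norm X dX dY f =
     (SUP (x, y) \<in> {(x, y). x \<in> X \<and> y \<in> X \<and> x \<noteq> y}. ennreal (dY (f x) (f y) / dX x y))"

definition distortion ::
    "'a set \<Rightarrow> ('a \<Rightarrow> 'a \<Rightarrow> real) \<Rightarrow> ('b \<Rightarrow> 'b \<Rightarrow> real) \<Rightarrow> ('a \<Rightarrow> 'b) \<Rightarrow> ennreal" where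
  "distortion X dX dY f =
     (if inj_on f X
      then lip_norm X dX dY f * lip_norm (f ` X) dY dX (inv_into X f)
      else \<infinity>)"

definition embedding ::
    "real \<Rightarrow> 'a set \<Rightarrow> ('a \<Rightarrow> 'a \<Rightarrow> real) \<Rightarrow> 'b set \<Rightarrow> ('b \<Rightarrow> 'b \<Rightarrow> real) \<Rightarrow> ('a \<Rightarrow> 'b) \<Rightarrow> bool" where
  "embedding D X dX Y dY f \<longleftrightarrow> f ` X \<subseteq> Y \<and> distortion X dX dY f \<le> ennreal D"

lemma Metric_space_l1: "Metric_space (carrier_vec d) (l1_dist d)"
proof
  fix x y z :: "real vec"
  show "0 \<le> l1_dist d x y"
    by (simp add: l1_dist_def sum_nonneg)
  show "l1_dist d x y = l1_dist d y x"
    by (simp add: l1_dist_def abs_minus_commute)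
  assume x: "x \<in> carrier_vec d" and y: "y \<in> carrier_vec d"
  show "l1_dist d x y = 0 \<longleftrightarrow> x = y"
    using x y by (auto simp: l1_dist_def sum_nonneg_eq_0_iff vec_eq_iff)
  assume z: "z \<in> carrier_vec d"
  show "l1_dist d x z \<le> l1_dist d x y + l1_dist d y z"
    by (auto simp: l1_dist_def sum.distrib[symmetric] intro!: sum_mono)
qed

lemma U_subset: "U n \<subseteq> carrier_vec n"
  by (auto simp: U_def)

text \<open>
  The lower bound below reads \<open>c log n / (\<epsilon> max{1, log (1/\<epsilon>)})\<close>. For \<open>\<epsilon> \<le> 1/e\<close> this is
  \<open>c log n / (\<epsilon> log (1/\<epsilon>))\<close>. As \<open>\<epsilon> \<rightarrow> 1\<close> the factor \<open>log (1/\<epsilon>)\<close> vanishes, and no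
  constant \<open>c > 0\<close> can work without the maximum, because dimension \<open>O(log n)\<close> suffices for
  distortion \<open>3/2\<close> (random binary vectors).
\<close>

end

theory Submission imports Defs "HOL-Analysis.Analysis" begin

text \<open>
  All distances in \<open>U n\<close> are equal, so a \<open>(1 + \<epsilon>)\<close>-embedding of \<open>U n\<close> yields \<open>n\<close> points of
  \<open>\<real>\<^sup>d\<close> whose mutual \<open>\<ell>\<^sub>1\<close> distances all lie between \<open>a\<close> and \<open>(1 + \<epsilon>) a\<close> for some
  \<open>a > 0\<close> (\<open>embedding_U_nearly_equilateral\<close>). The proof is a Plotkin-type bound
  for such a configuration. It rests on the \<^emph>\<open>spread\<close> of a set \<open>I\<close> of points, which is \<open>|I|\<close>
  times the mean distance of two independent random points of \<open>I\<close>. For \<open>\<ell>\<^sub>1\<close> distances the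
  spread is superadditive over disjoint sets (\<open>spread_l1_superadditive\<close>): an \<open>\<ell>\<^sub>1\<close> distance is an
  integral of cuts, and for a cut the claim is a case of the Cauchy-Schwarz inequality. Thus
  splitting a point set into classes does not increase the total spread.

  Let \<open>S\<close> be the \<open>\<theta> d\<close> (rounded up) coordinates that contribute most to the spread, for a
  \<open>\<theta>\<close> of order \<open>\<epsilon>\<close>; they carry at least the fraction \<open>\<theta>\<close> of it. Group the points into
  classes that have \<open>\<ell>\<^sub>1\<close> diameter at most \<open>\<epsilon> a / 4\<close> on \<open>S\<close>. An \<open>\<ell>\<^sub>1\<close> ball of radius
  \<open>2 a\<close> in dimension \<open>|S|\<close> is covered by \<open>N \<le> (60/\<epsilon>)\<close> to the power \<open>|S|\<close> such sets
  (\<open>l1_partition_small_diameter\<close>), so that many classes suffice. Two points of one class are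
  nearly as far apart on the remaining coordinates as they were altogether, so by superadditivity
  the remaining coordinates have spread at least \<open>(n - N) (1 - \<epsilon>/4) a\<close>. On the other hand this
  spread is at most \<open>(1 - \<theta>) n (1 + \<epsilon>) a\<close>. For \<open>\<theta> = 3\<epsilon> / (2 (1 + \<epsilon>))\<close> the two bounds
  force \<open>n \<le> 4 N / \<epsilon>\<close> (\<open>card_nearly_equilateral_le\<close>). Taking logarithms,
  \<open>ln n \<le> ln (4/\<epsilon>) + (3\<epsilon>d/2 + 1) ln (60/\<epsilon>)\<close>, and the terms without \<open>d\<close> are at most
  \<open>(ln n) / 2\<close> once \<open>n\<close> is large in terms of \<open>\<epsilon>\<close>.
\<close>

section \<open>Superadditivity of the spread\<close>

text \<open>
  Dividing by \<open>card I\<close>, and not by its square as in a mean distance, weights each class of a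
  partition by its size; only with this weighting can the spread be superadditive. Division by zero
  gives the empty set spread 0, which agrees with superadditivity.
\<close>

definition spread :: "('i \<Rightarrow> 'i \<Rightarrow> real) \<Rightarrow> 'i set \<Rightarrow> real" where
  "spread D I = (\<Sum>i\<in>I. \<Sum>j\<in>I. D i j) / real (card I)"

definition l1_on :: "'k set \<Rightarrow> ('i \<Rightarrow> 'k \<Rightarrow> real) \<Rightarrow> 'i \<Rightarrow> 'i \<Rightarrow> real" where
  "l1_on K x i j = (\<Sum>k\<in>K. \<bar>x i k - x j k\<bar>)"

lemma sum_square_div_le:
  fixes k1 k2 n1 n2 :: real
  assumes "n1 > 0" "n2 > 0"
  shows "(k1 + k2)\<^sup>2 / (n1 + n2) \<le> k1\<^sup>2 / n1 + k2\<^sup>2 / n2"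
proof -
  have "k1\<^sup>2 / n1 + k2\<^sup>2 / n2 - (k1 + k2)\<^sup>2 / (n1 + n2)
      = (k1 * n2 - k2 * n1)\<^sup>2 / (n1 * n2 * (n1 + n2))"
    using assms by (simp add: divide_simps) (simp add: algebra_simps power2_eq_square)
  also have "\<dots> \<ge> 0"
    using assms by simp
  finally show ?thesis by simp
qed

lemma spread_cut:
  fixes v :: "'i \<Rightarrow> real"
  assumes "finite I" "I \<noteq> {}" "\<And>i. i \<in> I \<Longrightarrow> v i = 0 \<or> v i = 1"
  shows "spread (\<lambda>i j. \<bar>v i - v j\<bar>) I = 2 * (sum v I - (sum v I)\<^sup>2 / real (card I))"
proof -
  have "(\<Sum>i\<in>I. \<Sum>j\<in>I. \<bar>v i - v j\<bar>) = (\<Sum>i\<in>I. \<Sum>j\<in>I. v i + v j - 2 * (v i * v j))"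
  proof (intro sum.cong refl)
    fix i j assume "i \<in> I" "j \<in> I"
    with assms(3)[of i] assms(3)[of j] show "\<bar>v i - v j\<bar> = v i + v j - 2 * (v i * v j)"
      by auto
  qed
  also have "\<dots> = 2 * (real (card I) * sum v I - (sum v I)\<^sup>2)"
    by (simp add: sum.distrib sum_subtractf flip: sum_distrib_left sum_distrib_right)
       (simp add: power2_eq_square algebra_simps sum_product flip: sum_distrib_left)
  finally show ?thesis
    using assms(1,2) by (simp add: spread_def field_simps card_gt_0_iff)
qed

text \<open>
  By \<open>spread_cut\<close>, only the term \<open>- (sum v I)\<^sup>2 / card I\<close> fails to be additive, and
  \<open>k\<^sup>2 / n\<close> is subadditive in the pair \<open>(k, n)\<close>.
\<close>

lemma spread_cut_superadditive:
  fixes v :: "'i \<Rightarrow> real"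
  assumes "finite A" "finite B" "A \<inter> B = {}"
    and "\<And>i. v i = 0 \<or> v i = 1"
  shows "spread (\<lambda>i j. \<bar>v i - v j\<bar>) A + spread (\<lambda>i j. \<bar>v i - v j\<bar>) B
       \<le> spread (\<lambda>i j. \<bar>v i - v j\<bar>) (A \<union> B)"
proof (cases "A = {} \<or> B = {}")
  case True
  then show ?thesis by (auto simp: spread_def)
next
  case False
  then have "real (card A) > 0" "real (card B) > 0"
    using assms by (auto simp: card_gt_0_iff)
  from sum_square_div_le[OF this, of "sum v A" "sum v B"] False assms show ?thesis
    by (simp add: spread_cut sum.union_disjoint card_Un_disjoint)
qed

text \<open>
  A threshold \<open>t\<close> separates \<open>a\<close> from \<open>b\<close> exactly when it lies between them, so \<open>\<bar>a - b\<bar>\<close> is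
  the integral over \<open>t\<close> of the cuts that the thresholds induce. This transfers linear inequalities from cuts
  to distances on the line.
\<close>

lemma integral_threshold_cut:
  fixes a b :: real
  shows "has_bochner_integral lborel (\<lambda>t. \<bar>indicator {..<a} t - indicator {..<b} t :: real\<bar>) \<bar>a - b\<bar>"
proof -
  have "\<bar>indicator {..<a} t - indicator {..<b} t :: real\<bar> = indicator {min a b..<max a b} t" for t
    by (auto simp: indicator_def)
  moreover have "has_bochner_integral lborel (indicator {min a b..<max a b}) \<bar>a - b\<bar>"
    using has_bochner_integral_real_indicator[of "{min a b..<max a b}" lborel]
    by (auto simp: min_def max_def split: if_splits)
  ultimately show ?thesis by simp
qed

lemma spread_abs_superadditive:
  fixes a :: "'i \<Rightarrow> real"
  assumes "finite A" "finite B" "A \<inter> B = {}"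
  shows "spread (\<lambda>i j. \<bar>a i - a j\<bar>) A + spread (\<lambda>i j. \<bar>a i - a j\<bar>) B
       \<le> spread (\<lambda>i j. \<bar>a i - a j\<bar>) (A \<union> B)"
proof -
  define cut :: "real \<Rightarrow> 'i \<Rightarrow> 'i \<Rightarrow> real"
    where "cut t i j = \<bar>indicator {..<a i} t - indicator {..<a j} t\<bar>" for t i j
  have int: "has_bochner_integral lborel (\<lambda>t. spread (cut t) I) (spread (\<lambda>i j. \<bar>a i - a j\<bar>) I)" for I
    unfolding spread_def cut_def
    by (intro has_bochner_integral_divide_zero has_bochner_integral_sum integral_threshold_cut)
  have "spread (cut t) A + spread (cut t) B \<le> spread (cut t) (A \<union> B)" for t
    unfolding cut_def
    by (rule spread_cut_superadditive[OF assms]) (auto simp: indicator_def)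
  then show ?thesis
    using has_bochner_integral_add[OF int[of A] int[of B]] int[of "A \<union> B"]
    by (metis (no_types, lifting) has_bochner_integral_iff integral_mono)
qed

lemma spread_l1_on: "spread (l1_on K x) I = (\<Sum>k\<in>K. spread (\<lambda>i j. \<bar>x i k - x j k\<bar>) I)"
proof -
  have "(\<Sum>i\<in>I. \<Sum>j\<in>I. l1_on K x i j) = (\<Sum>i\<in>I. \<Sum>k\<in>K. \<Sum>j\<in>I. \<bar>x i k - x j k\<bar>)"
    unfolding l1_on_def by (intro sum.cong refl sum.swap)
  also have "\<dots> = (\<Sum>k\<in>K. \<Sum>i\<in>I. \<Sum>j\<in>I. \<bar>x i k - x j k\<bar>)"
    by (rule sum.swap)
  finally show ?thesis by (simp add: spread_def sum_divide_distrib)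
qed

lemma spread_l1_superadditive:
  assumes "finite A" "finite B" "A \<inter> B = {}"
  shows "spread (l1_on K x) A + spread (l1_on K x) B \<le> spread (l1_on K x) (A \<union> B)"
  unfolding spread_l1_on
  by (simp add: sum.distrib[symmetric] sum_mono spread_abs_superadditive[OF assms])

text \<open>
  Two random points of the same class are, on average over the classes, no farther apart than two
  random points of the whole set.
\<close>

lemma spread_l1_partition:
  assumes "finite I"
  shows "(\<Sum>c\<in>g ` I. spread (l1_on K x) {i \<in> I. g i = c}) \<le> spread (l1_on K x) I"
proof -
  have "(\<Sum>c\<in>C. spread (l1_on K x) {i \<in> I. g i = c}) \<le> spread (l1_on K x) {i \<in> I. g i \<in> C}"
    if "finite C" for C
    using that
  proof (induction C)
    case empty
    then show ?case by (simp add: spread_def)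
  next
    case (insert c C)
    have "spread (l1_on K x) {i \<in> I. g i = c} + spread (l1_on K x) {i \<in> I. g i \<in> C}
        \<le> spread (l1_on K x) ({i \<in> I. g i = c} \<union> {i \<in> I. g i \<in> C})"
      using assms insert by (intro spread_l1_superadditive) auto
    also have "{i \<in> I. g i = c} \<union> {i \<in> I. g i \<in> C} = {i \<in> I. g i \<in> insert c C}"
      by auto
    finally show ?case using insert by simp
  qed
  from this[of "g ` I"] show ?thesis
    using assms by (simp add: Collect_conj_eq Int_absorb2 image_subset_iff subset_eq cong: conj_cong)
qed

lemma spread_ge:
  assumes "finite I" "I \<noteq> {}"
    and "\<And>i j. i \<in> I \<Longrightarrow> j \<in> I \<Longrightarrow> i \<noteq> j \<Longrightarrow> b \<le> D i j" "\<And>i. D i i = 0"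
  shows "(real (card I) - 1) * b \<le> spread D I"
proof -
  have "(real (card I) - 1) * b \<le> (\<Sum>j\<in>I. D i j)" if "i \<in> I" for i
  proof -
    have "(real (card I) - 1) * b = (\<Sum>j\<in>I - {i}. b)"
    proof -
      have "real (card I) = real (card (I - {i})) + 1"
        using card.remove[OF assms(1) that] by simp
      then show ?thesis by simp
    qed
    also have "\<dots> \<le> (\<Sum>j\<in>I - {i}. D i j)"
      using assms(3) that by (intro sum_mono) auto
    also have "\<dots> = (\<Sum>j\<in>I. D i j)"
      using assms(1,4) that by (simp add: sum.remove)
    finally show ?thesis .
  qed
  then have "(\<Sum>i\<in>I. (real (card I) - 1) * b) \<le> (\<Sum>i\<in>I. \<Sum>j\<in>I. D i j)"
    by (rule sum_mono)
  then show ?thesis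
    using assms(1,2) by (simp add: spread_def field_simps card_gt_0_iff)
qed

lemma spread_le:
  assumes "finite I" "b \<ge> 0" "\<And>i j. i \<in> I \<Longrightarrow> j \<in> I \<Longrightarrow> D i j \<le> b"
  shows "spread D I \<le> real (card I) * b"
proof -
  have "(\<Sum>i\<in>I. \<Sum>j\<in>I. D i j) \<le> (\<Sum>i\<in>I. \<Sum>j\<in>I. b)"
    using assms(3) by (intro sum_mono)
  then show ?thesis
    using assms(1,2) by (cases "I = {}") (simp_all add: spread_def field_simps card_gt_0_iff)
qed

section \<open>Heavy coordinates\<close>

text \<open>
  Discard least elements one at a time: removing the minimum cannot decrease the average weight.
\<close>

lemma heavy_subset_of_card:
  fixes w :: "'k \<Rightarrow> real"
  assumes "finite K" "s \<le> card K"
  shows "\<exists>S\<subseteq>K. card S = s \<and> real s * sum w K \<le> real (card K) * sum w S"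
  using assms(2)
proof (induction rule: inc_induct)
  case base
  then show ?case by (intro exI[of _ K]) simp
next
  case (step s)
  then obtain S where S: "S \<subseteq> K" "card S = Suc s"
    "real (Suc s) * sum w K \<le> real (card K) * sum w S" by blast
  then have fin: "finite S" "S \<noteq> {}" using assms(1) finite_subset by auto
  then obtain m where m: "m \<in> S" "\<And>k. k \<in> S \<Longrightarrow> w m \<le> w k"
    using ex_min_if_finite[of "w ` S"] by (metis (no_types) arg_min_if_finite(1) arg_min_least)
  have "real (Suc s) * w m = (\<Sum>k\<in>S. w m)" using S by simp
  also have "\<dots> \<le> sum w S" using m by (intro sum_mono)
  finally have "real s * sum w S \<le> real (Suc s) * sum w (S - {m})"
    using fin m by (simp add: sum_diff1 algebra_simps)
  then have "real (card K) * (real s * sum w S) \<le> real (card K) * (real (Suc s) * sum w (S - {m}))"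
    by (rule mult_left_mono) simp
  moreover have "real s * (real (Suc s) * sum w K) \<le> real s * (real (card K) * sum w S)"
    using S(3) by (rule mult_left_mono) simp
  ultimately have "real (Suc s) * (real s * sum w K) \<le> real (Suc s) * (real (card K) * sum w (S - {m}))"
    by (simp only: mult_ac)
  then have "real s * sum w K \<le> real (card K) * sum w (S - {m})"
    by (rule mult_left_le_imp_le) simp
  then show ?case using S fin m by (intro exI[of _ "S - {m}"]) auto
qed

lemma heavy_subset:
  fixes w :: "'k \<Rightarrow> real"
  assumes "finite K" "\<And>k. k \<in> K \<Longrightarrow> 0 \<le> w k" "0 \<le> \<theta>" "\<theta> \<le> 1"
  shows "\<exists>S\<subseteq>K. card S = nat \<lceil>\<theta> * real (card K)\<rceil> \<and> \<theta> * sum w K \<le> sum w S"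
proof (cases "card K = 0")
  case True
  then show ?thesis using assms(1) by auto
next
  case False
  define s where "s = nat \<lceil>\<theta> * real (card K)\<rceil>"
  have "\<theta> * real (card K) \<le> real (card K)"
    using assms by (simp add: mult_left_le_one_le)
  then have "s \<le> card K" unfolding s_def by linarith
  from heavy_subset_of_card[OF assms(1) this, of w] obtain S where
    S: "S \<subseteq> K" "card S = s" "real s * sum w K \<le> real (card K) * sum w S" by blast
  have "\<theta> * real (card K) * sum w K \<le> real s * sum w K"
    using assms by (intro mult_right_mono sum_nonneg) (auto simp: s_def real_nat_ceiling_ge)
  with S(3) have "real (card K) * (\<theta> * sum w K) \<le> real (card K) * sum w S"
    by (simp add: mult_ac)
  with False S show ?thesis unfolding s_def by (intro exI[of _ S]) auto
qed

section \<open>Covering an \<open>\<ell>\<^sub>1\<close> ball\<close>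

lemma sum_exp_int_le:
  fixes y :: real
  assumes "y > 0"
  shows "(\<Sum>z\<in>{-int m..int m}. exp (- y * real_of_int \<bar>z\<bar>)) \<le> 2 * (1 / y + 1)"
proof -
  let ?q = "exp (- y)"
  have q: "?q ^ k = exp (- y * real k)" for k by (simp add: exp_of_nat_mult[symmetric] mult_ac)
  have geo: "(\<Sum>k\<le>m. ?q ^ k) \<le> 1 / y + 1"
  proof -
    have "?q < 1" using assms by simp
    have "(\<Sum>k\<le>m. ?q ^ k) \<le> (\<Sum>k. ?q ^ k)"
      using \<open>?q < 1\<close> by (intro sum_le_suminf summable_geometric) auto
    also have "\<dots> = 1 / (1 - ?q)" using \<open>?q < 1\<close> by (intro suminf_geometric) simp
    also have "\<dots> \<le> 1 / y + 1"
    proof -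
      have "1 + y \<le> exp y" by (rule exp_ge_add_one_self)
      then have "?q \<le> 1 / (1 + y)" using assms by (simp add: exp_minus field_simps)
      then have "y / (1 + y) \<le> 1 - ?q" using assms by (simp add: field_simps)
      then have "1 / (1 - ?q) \<le> 1 / (y / (1 + y))" using assms by (intro divide_left_mono) auto
      then show ?thesis using assms by (simp add: field_simps)
    qed
    finally show ?thesis .
  qed
  have "(\<Sum>z\<in>{-int m..int m}. exp (- y * real_of_int \<bar>z\<bar>))
      \<le> (\<Sum>z\<in>int ` {..m} \<union> (\<lambda>k. - int k) ` {..m}. exp (- y * real_of_int \<bar>z\<bar>))"
  proof (intro sum_mono2)
    show "{- int m..int m} \<subseteq> int ` {..m} \<union> (\<lambda>k. - int k) ` {..m}"
    proof
      fix z assume "z \<in> {- int m..int m}"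
      then show "z \<in> int ` {..m} \<union> (\<lambda>k. - int k) ` {..m}"
        by (cases "z \<ge> 0") (auto simp: image_iff intro: bexI[of _ "nat z"] bexI[of _ "nat (- z)"])
    qed
  qed auto
  also have "\<dots> \<le> (\<Sum>z\<in>int ` {..m}. exp (- y * real_of_int \<bar>z\<bar>))
      + (\<Sum>z\<in>(\<lambda>k. - int k) ` {..m}. exp (- y * real_of_int \<bar>z\<bar>))"
    by (subst sum.union_inter[symmetric]) (auto intro!: sum_nonneg)
  also have "\<dots> = 2 * (\<Sum>k\<le>m. ?q ^ k)"
    by (simp add: sum.reindex inj_on_def q)
  also have "\<dots> \<le> 2 * (1 / y + 1)" using geo by simp
  finally show ?thesis .
qed

text \<open>
  Exponential weights (Chernoff's method): each integer point of the ball of radius \<open>A s\<close>, where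
  \<open>s = card S\<close>, has weight \<open>exp (- |z| / A) \<ge> exp (- s)\<close>, and the total weight of all integer
  points factors into \<open>s\<close> two-sided geometric series.
\<close>

lemma card_int_l1_ball_le:
  fixes A :: real
  assumes "finite S" "A > 0"
  defines "Z \<equiv> {z \<in> S \<rightarrow>\<^sub>E (UNIV :: int set). real_of_int (\<Sum>k\<in>S. \<bar>z k\<bar>) \<le> A * real (card S)}"
  shows "finite Z" "real (card Z) \<le> (exp 1 * (2 * (A + 1))) ^ card S"
proof -
  define m where "m = nat \<lfloor>A * real (card S)\<rfloor>"
  define P where "P = S \<rightarrow>\<^sub>E {- int m..int m}"
  \<comment> \<open>The ball lies in a finite cube, so that all sums below are finite.\<close>
  have finP: "finite P" unfolding P_def using assms(1) by (intro finite_PiE) auto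
  have sub: "Z \<subseteq> P"
  proof
    fix z assume z: "z \<in> Z"
    have bound: "\<bar>z k\<bar> \<le> int m" if "k \<in> S" for k
    proof -
      have "\<bar>z k\<bar> \<le> (\<Sum>k\<in>S. \<bar>z k\<bar>)"
        using assms(1) that by (intro member_le_sum) auto
      then have "real_of_int \<bar>z k\<bar> \<le> real_of_int (\<Sum>k\<in>S. \<bar>z k\<bar>)"
        by (simp only: of_int_le_iff)
      also have "\<dots> \<le> A * real (card S)"
        using z unfolding Z_def by blast
      finally have "\<bar>z k\<bar> \<le> \<lfloor>A * real (card S)\<rfloor>"
        by (simp only: le_floor_iff)
      then show ?thesis unfolding m_def by linarith
    qed
    show "z \<in> P"
      unfolding P_def
    proof (rule PiE_I)
      fix k assume "k \<in> S"
      from bound[OF this] show "z k \<in> {- int m..int m}" by (simp add: abs_le_iff)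
    next
      fix k assume "k \<notin> S"
      with z show "z k = undefined" unfolding Z_def by (blast dest: PiE_arb)
    qed
  qed
  then show "finite Z" using finP finite_subset by blast
  let ?E = "\<lambda>z :: 'a \<Rightarrow> int. exp (- (1 / A) * real_of_int (\<Sum>k\<in>S. \<bar>z k\<bar>))"
  have "real (card Z) * exp (- real (card S)) = (\<Sum>z\<in>Z. exp (- real (card S)))" by simp
  also have "\<dots> \<le> (\<Sum>z\<in>Z. ?E z)"
    using assms(2) by (intro sum_mono) (auto simp: Z_def field_simps)
  also have "\<dots> \<le> (\<Sum>z\<in>P. ?E z)"
    using finP sub by (intro sum_mono2) auto
  also have "\<dots> = (\<Sum>z\<in>P. \<Prod>k\<in>S. exp (- (1 / A) * real_of_int \<bar>z k\<bar>))"
    using assms(1) by (simp add: exp_sum[symmetric] sum_divide_distrib sum_negf)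
  also have "\<dots> = (\<Prod>k\<in>S. \<Sum>z\<in>{- int m..int m}. exp (- (1 / A) * real_of_int \<bar>z\<bar>))"
    unfolding P_def using assms(1) by (subst prod_sum_PiE) auto
  also have "\<dots> \<le> (\<Prod>k\<in>S. 2 * (A + 1))"
    using sum_exp_int_le[of "1 / A" m] assms(2) by (intro prod_mono) (auto intro!: sum_nonneg)
  finally have "real (card Z) * exp (- real (card S)) \<le> (2 * (A + 1)) ^ card S" by simp
  then have "real (card Z) \<le> exp (real (card S)) * (2 * (A + 1)) ^ card S"
    by (simp add: exp_minus field_simps)
  also have "exp (real (card S)) = exp 1 ^ card S"
    by (simp add: exp_of_nat_mult[symmetric])
  finally show "real (card Z) \<le> (exp 1 * (2 * (A + 1))) ^ card S"
    by (simp add: power_mult_distrib)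
qed

text \<open>
  Label each point by its position relative to \<open>p\<close>, rounded down to a grid of width
  \<open>r / card S\<close>. Equal labels mean a difference of at most one grid width in each coordinate, hence
  at most \<open>r\<close> in total. Rounding adds at most 1 per coordinate, so the labels are integer points
  of \<open>\<ell>\<^sub>1\<close> norm at most \<open>(R/r + 1) card S\<close>.
\<close>

lemma l1_partition_small_diameter:
  fixes x :: "'i \<Rightarrow> 'k \<Rightarrow> real"
  assumes "finite S" "r > 0" "R \<ge> 0" "\<And>i. i \<in> I \<Longrightarrow> l1_on S x i p \<le> R"
  obtains g :: "'i \<Rightarrow> 'k \<Rightarrow> int" where
    "real (card (g ` I)) \<le> (exp 1 * (2 * (R / r + 2))) ^ card S"
    "\<And>i j. g i = g j \<Longrightarrow> l1_on S x i j \<le> r"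
proof -
  define s where "s = real (card S)"
  define h where "h i k = (x i k - x p k) * s / r" for i k
  define g where "g i = (\<lambda>k\<in>S. \<lfloor>h i k\<rfloor>)" for i
  have spos: "s > 0" if "k \<in> S" for k
    using that assms(1) by (auto simp: s_def card_gt_0_iff)
  have sum_g: "real_of_int (\<Sum>k\<in>S. \<bar>g i k\<bar>) \<le> (R / r + 1) * real (card S)" if "i \<in> I" for i
  proof -
    have "real_of_int (\<Sum>k\<in>S. \<bar>g i k\<bar>) \<le> (\<Sum>k\<in>S. \<bar>x i k - x p k\<bar> * (s / r) + 1)"
      unfolding of_int_sum
    proof (intro sum_mono)
      fix k assume k: "k \<in> S"
      have "\<bar>h i k\<bar> = \<bar>x i k - x p k\<bar> * (s / r)"
        using assms(2) by (simp add: h_def abs_mult s_def)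
      then show "real_of_int \<bar>g i k\<bar> \<le> \<bar>x i k - x p k\<bar> * (s / r) + 1"
        using k by (simp add: g_def) linarith
    qed
    also have "\<dots> = l1_on S x i p * (s / r) + s"
      by (simp only: l1_on_def sum.distrib sum_distrib_right) (simp add: s_def)
    also have "\<dots> \<le> R * (s / r) + s"
      using assms that by (intro add_right_mono mult_right_mono) (auto simp: s_def)
    finally show ?thesis by (simp add: s_def algebra_simps)
  qed
  have pos: "0 < R / r + 1" using assms by (simp add: add_nonneg_pos)
  have "g ` I \<subseteq> {z \<in> S \<rightarrow>\<^sub>E UNIV. real_of_int (\<Sum>k\<in>S. \<bar>z k\<bar>) \<le> (R / r + 1) * real (card S)}"
    using sum_g by (auto simp: g_def)
  then have "real (card (g ` I)) \<le> (exp 1 * (2 * (R / r + 1 + 1))) ^ card S"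
    using card_int_l1_ball_le[OF assms(1) pos] by (meson card_mono of_nat_mono order_trans)
  then have 1: "real (card (g ` I)) \<le> (exp 1 * (2 * (R / r + 2))) ^ card S"
    by (simp add: add.assoc)
  have 2: "l1_on S x i j \<le> r" if "g i = g j" for i j
  proof (cases "S = {}")
    case True
    then show ?thesis using assms(2) by (simp add: l1_on_def)
  next
    case False
    have "l1_on S x i j \<le> (\<Sum>k\<in>S. r / s)"
      unfolding l1_on_def
    proof (intro sum_mono)
      fix k assume k: "k \<in> S"
      have "\<lfloor>h i k\<rfloor> = \<lfloor>h j k\<rfloor>" using fun_cong[OF that, of k] k by (simp add: g_def)
      then have "\<bar>h i k - h j k\<bar> \<le> 1" by linarith
      moreover have "h i k - h j k = (x i k - x j k) * (s / r)"
        by (simp add: h_def algebra_simps diff_divide_distrib)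
      ultimately have "\<bar>x i k - x j k\<bar> * (s / r) \<le> 1"
        using spos[OF k] assms(2) by (simp add: abs_mult)
      then show "\<bar>x i k - x j k\<bar> \<le> r / s"
        using spos[OF k] assms(2) by (simp add: field_simps)
    qed
    also have "\<dots> = r" using False assms(1) by (simp add: s_def)
    finally show ?thesis .
  qed
  from 1 2 show ?thesis by (rule that)
qed

section \<open>Nearly equilateral sets\<close>

text \<open>
  The spread of the coordinates outside the heavy set \<open>S\<close> is bounded below through the classes
  and above through the heaviness of \<open>S\<close>; the chain of inequalities in the middle of the proof
  compares the two bounds. Its outcome \<open>(n - N) (1 - \<epsilon>/4) \<le> n (1 - \<epsilon>/2)\<close> leaves no room for
  \<open>N\<close> to be much smaller than \<open>\<epsilon> n\<close>.
\<close>

lemma card_nearly_equilateral_le: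
  fixes x :: "'i \<Rightarrow> 'k \<Rightarrow> real"
  assumes "finite I" "finite K" "0 < \<epsilon>" "\<epsilon> < 1" "0 < a"
    and lo: "\<And>i j. i \<in> I \<Longrightarrow> j \<in> I \<Longrightarrow> i \<noteq> j \<Longrightarrow> a \<le> l1_on K x i j"
    and hi: "\<And>i j. i \<in> I \<Longrightarrow> j \<in> I \<Longrightarrow> i \<noteq> j \<Longrightarrow> l1_on K x i j \<le> (1 + \<epsilon>) * a"
  shows "real (card I) \<le> 4 / \<epsilon> * (60 / \<epsilon>) ^ nat \<lceil>3 * \<epsilon> / (2 * (1 + \<epsilon>)) * real (card K)\<rceil>"
proof (cases "I = {}")
  case True
  then show ?thesis using assms by simp
next
  case False
  then obtain p where p: "p \<in> I" by blast
  define n where "n = real (card I)"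
  \<comment> \<open>This value gives \<open>(1 - \<theta>) (1 + \<epsilon>) = 1 - \<epsilon>/2\<close>, and it stays below 1 for all \<open>\<epsilon> < 1\<close>.\<close>
  define \<theta> where "\<theta> = 3 * \<epsilon> / (2 * (1 + \<epsilon>))"
  have \<theta>: "0 \<le> \<theta>" "\<theta> \<le> 1" using assms(3,4) by (auto simp: \<theta>_def field_simps)
  have refl0: "l1_on T x i i = 0" for T i by (simp add: l1_on_def)
  have hi': "l1_on K x i j \<le> (1 + \<epsilon>) * a" if "i \<in> I" "j \<in> I" for i j
    using hi[OF that] refl0[of K i] assms(3,5) by (cases "i = j") auto
  obtain S where S: "S \<subseteq> K" "card S = nat \<lceil>\<theta> * real (card K)\<rceil>"
    and heavy: "\<theta> * spread (l1_on K x) I \<le> spread (l1_on S x) I"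
    using heavy_subset[OF assms(2) _ \<theta>, of "\<lambda>k. spread (\<lambda>i j. \<bar>x i k - x j k\<bar>) I"]
    unfolding spread_l1_on by (auto simp: spread_def sum_nonneg)
  have finS: "finite S" using S assms(2) finite_subset by blast
  have split: "l1_on K x i j = l1_on S x i j + l1_on (K - S) x i j" for i j
    unfolding l1_on_def using S assms(2) by (metis add.commute sum.subset_diff)
  have S_le_K: "l1_on S x i j \<le> l1_on K x i j" for i j
    unfolding l1_on_def using S assms(2) by (intro sum_mono2) auto
  have S_diam: "l1_on S x i p \<le> 2 * a" if "i \<in> I" for i
  proof -
    have "(1 + \<epsilon>) * a \<le> 2 * a" using assms by (intro mult_right_mono) auto
    then show ?thesis using S_le_K[of i p] hi'[OF that p] by linarith
  qed
  obtain g :: "'i \<Rightarrow> 'k \<Rightarrow> int" where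
    cardg: "real (card (g ` I)) \<le> (exp 1 * (2 * (2 * a / (\<epsilon> / 4 * a) + 2))) ^ card S" and
    gdiam: "\<And>i j. g i = g j \<Longrightarrow> l1_on S x i j \<le> \<epsilon> / 4 * a"
    by (rule l1_partition_small_diameter[OF finS _ _ S_diam, of "\<epsilon> / 4 * a"]) (use assms in auto)
  define N where "N = real (card (g ` I))"
  have "exp 1 * (2 * (2 * a / (\<epsilon> / 4 * a) + 2)) \<le> 3 * (20 / \<epsilon>)"
  proof (intro mult_mono)
    show "2 * (2 * a / (\<epsilon> / 4 * a) + 2) \<le> 20 / \<epsilon>"
      using assms(3-5) by (simp add: field_simps)
  qed (use assms exp_le in auto)
  then have "(exp 1 * (2 * (2 * a / (\<epsilon> / 4 * a) + 2))) ^ card S \<le> (60 / \<epsilon>) ^ card S"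
    using assms(3-5) by (intro power_mono) auto
  with cardg have N: "N \<le> (60 / \<epsilon>) ^ card S" by (simp add: N_def)
  have "(n - N) * ((1 - \<epsilon> / 4) * a)
      = (\<Sum>c\<in>g ` I. (real (card {i \<in> I. g i = c}) - 1) * ((1 - \<epsilon> / 4) * a))"
  proof -
    have "card I = (\<Sum>c\<in>g ` I. card {i \<in> I. g i = c})"
      using assms(1) by (subst card_eq_sum, subst sum.image_gen[of _ _ g]) auto
    then have "n = (\<Sum>c\<in>g ` I. real (card {i \<in> I. g i = c}))" by (simp add: n_def)
    then show ?thesis by (simp add: N_def sum_subtractf flip: sum_distrib_right)
  qed
  \<comment> \<open>Within a class, the coordinates in \<open>S\<close> account for at most \<open>\<epsilon> a / 4\<close> of the distance.\<close>
  also have "\<dots> \<le> (\<Sum>c\<in>g ` I. spread (l1_on (K - S) x) {i \<in> I. g i = c})"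
  proof (intro sum_mono spread_ge)
    fix c i j assume "i \<in> {i \<in> I. g i = c}" "j \<in> {i \<in> I. g i = c}" "i \<noteq> j"
    then have "a \<le> l1_on K x i j" "l1_on S x i j \<le> \<epsilon> / 4 * a" using lo gdiam by auto
    then show "(1 - \<epsilon> / 4) * a \<le> l1_on (K - S) x i j"
      using split[of i j] by (simp add: algebra_simps)
  qed (use assms(1) refl0 in auto)
  also have "\<dots> \<le> spread (l1_on (K - S) x) I"
    by (rule spread_l1_partition[OF assms(1)])
  also have "\<dots> = spread (l1_on K x) I - spread (l1_on S x) I"
    unfolding spread_l1_on using S assms(2) by (simp add: sum.subset_diff)
  also have "\<dots> \<le> (1 - \<theta>) * spread (l1_on K x) I"
    using heavy by (simp add: algebra_simps)
  also have "\<dots> \<le> (1 - \<theta>) * (n * ((1 + \<epsilon>) * a))"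
    unfolding n_def using assms \<theta> hi' by (intro mult_left_mono spread_le) auto
  also have "\<dots> = n * (1 - \<epsilon> / 2) * a"
    using assms(3) by (simp add: \<theta>_def field_simps)
  finally have "(n - N) * (1 - \<epsilon> / 4) \<le> n * (1 - \<epsilon> / 2)"
    using assms(5) by (simp flip: mult.assoc)
  moreover have "n * (\<epsilon> / 4) - N * (1 - \<epsilon> / 4) = (n - N) * (1 - \<epsilon> / 4) - n * (1 - \<epsilon> / 2)"
    by (simp add: field_simps)
  ultimately have "n * (\<epsilon> / 4) \<le> N * (1 - \<epsilon> / 4)" by linarith
  also have "\<dots> \<le> N" using assms(3) by (simp add: N_def algebra_simps)
  finally have "n \<le> 4 / \<epsilon> * N" using assms(3) by (simp add: field_simps)
  also have "\<dots> \<le> 4 / \<epsilon> * (60 / \<epsilon>) ^ card S"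
    using N assms(3) by (intro mult_left_mono) auto
  finally show ?thesis by (simp add: n_def S(2) \<theta>_def)
qed

section \<open>Embeddings of the standard basis\<close>

lemma l1_dist_unit_vec:
  assumes "i < n" "j < n" "i \<noteq> j"
  shows "l1_dist n (unit_vec n i) (unit_vec n j) = 2"
proof -
  have "l1_dist n (unit_vec n i) (unit_vec n j)
      = (\<Sum>k<n. (if k = i then 1 else 0) + (if k = j then 1 else 0))"
    unfolding l1_dist_def using assms by (intro sum.cong) auto
  also have "\<dots> = 2" using assms by (simp add: sum.distrib)
  finally show ?thesis .
qed

lemma distance_ratio_le_distortion:
  assumes "inj_on f X" "x \<in> X" "x' \<in> X" "x \<noteq> x'" "y \<in> X" "y' \<in> X" "y \<noteq> y'"
    and "0 \<le> dY (f x) (f x') / dX x x'"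
  shows "ennreal (dY (f x) (f x') / dX x x' * (dX y y' / dY (f y) (f y'))) \<le> distortion X dX dY f"
proof -
  have "ennreal (dY (f x) (f x') / dX x x') \<le> lip_norm X dX dY f"
    unfolding lip_norm_def using assms by (intro SUP_upper2[of "(x, x')"]) auto
  moreover have "ennreal (dX y y' / dY (f y) (f y')) \<le> lip_norm (f ` X) dY dX (inv_into X f)"
    unfolding lip_norm_def using assms
    by (intro SUP_upper2[of "(f y, f y')"]) (auto simp: inj_on_eq_iff)
  ultimately have "ennreal (dY (f x) (f x') / dX x x') * ennreal (dX y y' / dY (f y) (f y'))
      \<le> distortion X dX dY f"
    using assms(1) by (simp only: distortion_def if_True) (intro mult_mono; simp)
  then show ?thesis
    by (simp only: ennreal_mult'[OF assms(8)])
qed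

text \<open>
  All distances in \<open>U n\<close> equal 2, so by \<open>distance_ratio_le_distortion\<close> the ratio of any two
  image distances is at most the distortion. Hence the least image distance serves as \<open>a\<close>; it is
  positive because finite distortion includes injectivity.
\<close>

lemma embedding_U_nearly_equilateral:
  assumes "embedding D (U n) (l1_dist n) (carrier_vec d) (l1_dist d) f" "D \<ge> 0"
    and "n \<ge> 2"
  obtains a where "a > 0"
    "\<And>i j. i < n \<Longrightarrow> j < n \<Longrightarrow> i \<noteq> j \<Longrightarrow> a \<le> l1_dist d (f (unit_vec n i)) (f (unit_vec n j))"
    "\<And>i j. i < n \<Longrightarrow> j < n \<Longrightarrow> i \<noteq> j \<Longrightarrow> l1_dist d (f (unit_vec n i)) (f (unit_vec n j)) \<le> D * a"
proof -
  interpret Metric_space "carrier_vec d" "l1_dist d" by (rule Metric_space_l1)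
  define \<delta> where "\<delta> = (\<lambda>(i, j). l1_dist d (f (unit_vec n i)) (f (unit_vec n j)))"
  define P where "P = {(i, j). i < n \<and> j < n \<and> i \<noteq> j}"
  have dist_le: "distortion (U n) (l1_dist n) (l1_dist d) f \<le> ennreal D"
    and range: "f ` U n \<subseteq> carrier_vec d"
    using assms(1) by (auto simp: embedding_def)
  have inj: "inj_on f (U n)"
    using dist_le by (auto simp: distortion_def split: if_splits simp: top_unique)
  have pos: "\<delta> p > 0" if "p \<in> P" for p
  proof -
    obtain i j where p: "p = (i, j)" "i < n" "j < n" "i \<noteq> j" using \<open>p \<in> P\<close> by (auto simp: P_def)
    then have "f (unit_vec n i) \<noteq> f (unit_vec n j)"
      using inj by (auto simp: inj_on_eq_iff U_def)
    moreover have "f (unit_vec n i) \<in> carrier_vec d" "f (unit_vec n j) \<in> carrier_vec d"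
      using p range by (auto simp: U_def)
    ultimately show ?thesis
      using p mdist_pos_less by (simp add: \<delta>_def)
  qed
  have ratio: "\<delta> p \<le> D * \<delta> q" if "p \<in> P" "q \<in> P" for p q
  proof -
    obtain i j i' j' where p: "p = (i, j)" "i < n" "j < n" "i \<noteq> j"
      and q: "q = (i', j')" "i' < n" "j' < n" "i' \<noteq> j'" using \<open>p \<in> P\<close> \<open>q \<in> P\<close> by (auto simp: P_def)
    have "ennreal (\<delta> p / 2 * (2 / \<delta> q)) \<le> ennreal D"
      using distance_ratio_le_distortion[OF inj, of "unit_vec n i" "unit_vec n j"
          "unit_vec n i'" "unit_vec n j'" "l1_dist d" "l1_dist n"] p q dist_le
      by (auto simp: \<delta>_def U_def l1_dist_unit_vec)
    then have "\<delta> p / \<delta> q \<le> D" using assms(2) by simp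
    then show ?thesis using pos[OF \<open>q \<in> P\<close>] by (simp add: field_simps)
  qed
  have "finite P" by (rule finite_subset[of _ "{..<n} \<times> {..<n}"]) (auto simp: P_def)
  moreover have "(0, 1) \<in> P" using assms(3) by (auto simp: P_def)
  ultimately obtain q where q: "q \<in> P" "\<And>p. p \<in> P \<Longrightarrow> \<delta> q \<le> \<delta> p"
    by (metis arg_min_if_finite(1) arg_min_least empty_iff)
  show ?thesis
  proof (rule that[of "\<delta> q"])
    fix i j assume "i < n" "j < n" "i \<noteq> j"
    then have "(i, j) \<in> P" by (simp add: P_def)
    then show "\<delta> q \<le> l1_dist d (f (unit_vec n i)) (f (unit_vec n j))"
      "l1_dist d (f (unit_vec n i)) (f (unit_vec n j)) \<le> D * \<delta> q"
      using q ratio[of "(i, j)" q] by (auto simp: \<delta>_def)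
  qed (use pos q in auto)
qed

theorem theorem2:
  "\<exists>c::real. c > 0 \<and>
     (\<forall>\<epsilon>::real. 0 < \<epsilon> \<and> \<epsilon> < 1 \<longrightarrow>
       (\<forall>\<^sub>F n in sequentially. \<forall>(d::nat) (f :: real vec \<Rightarrow> real vec).
          embedding (1 + \<epsilon>) (U n) (l1_dist n) (carrier_vec d) (l1_dist d) f \<longrightarrow>
            real d \<ge> c * ln (real n) / (\<epsilon> * max 1 (ln (1 / \<epsilon>)))))"
proof (intro exI[of _ "1 / (3 * (1 + ln 60))"] conjI allI impI)
  have [simp]: "ln (60::real) > 0" by simp
  then show "1 / (3 * (1 + ln 60)) > (0::real)" by (simp add: add_pos_pos)
  fix \<epsilon> :: real assume "0 < \<epsilon> \<and> \<epsilon> < 1"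
  then have \<epsilon>: "0 < \<epsilon>" "\<epsilon> < 1" by auto
  define M where "M = max 1 (ln (1 / \<epsilon>))"
  have M: "M \<ge> 1" "ln (1 / \<epsilon>) \<le> M" by (auto simp: M_def)
  have "LIM n sequentially. ln (real n) :> at_top"
    by (intro filterlim_compose[OF ln_at_top] filterlim_real_sequentially)
  then have "\<forall>\<^sub>F n in sequentially. 2 * (ln (4 / \<epsilon>) + ln (60 / \<epsilon>)) \<le> ln (real n)"
    by (simp add: filterlim_at_top)
  then show "\<forall>\<^sub>F n in sequentially. \<forall>d (f :: real vec \<Rightarrow> real vec).
      embedding (1 + \<epsilon>) (U n) (l1_dist n) (carrier_vec d) (l1_dist d) f \<longrightarrow>
      1 / (3 * (1 + ln 60)) * ln (real n) / (\<epsilon> * max 1 (ln (1 / \<epsilon>))) \<le> real d"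
    using eventually_ge_at_top[of 2]
  proof eventually_elim
    case (elim n)
    show ?case
    proof (intro allI impI)
      fix d :: nat and f :: "real vec \<Rightarrow> real vec"
      assume "embedding (1 + \<epsilon>) (U n) (l1_dist n) (carrier_vec d) (l1_dist d) f"
      then obtain a where a: "a > 0"
        "\<And>i j. i < n \<Longrightarrow> j < n \<Longrightarrow> i \<noteq> j \<Longrightarrow> a \<le> l1_dist d (f (unit_vec n i)) (f (unit_vec n j))"
        "\<And>i j. i < n \<Longrightarrow> j < n \<Longrightarrow> i \<noteq> j \<Longrightarrow>
           l1_dist d (f (unit_vec n i)) (f (unit_vec n j)) \<le> (1 + \<epsilon>) * a"
        using embedding_U_nearly_equilateral[of "1 + \<epsilon>" n d f] \<epsilon> elim by auto
      define s where "s = nat \<lceil>3 * \<epsilon> / (2 * (1 + \<epsilon>)) * real d\<rceil>"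
      have "real n \<le> 4 / \<epsilon> * (60 / \<epsilon>) ^ s"
        using card_nearly_equilateral_le[of "{..<n}" "{..<d}" \<epsilon> a "\<lambda>i k. vec_index (f (unit_vec n i)) k"] \<epsilon> a
        by (simp add: l1_on_def l1_dist_def s_def)
      then have "ln (real n) \<le> ln (4 / \<epsilon> * (60 / \<epsilon>) ^ s)"
        using elim by simp
      also have "\<dots> = ln (4 / \<epsilon>) + real s * ln (60 / \<epsilon>)"
        using \<epsilon> by (subst ln_mult) (auto simp: ln_realpow)
      also have "\<dots> \<le> ln (4 / \<epsilon>) + (3 / 2 * \<epsilon> * real d + 1) * ln (60 / \<epsilon>)"
      proof (intro add_left_mono mult_right_mono)
        have "3 * \<epsilon> / (2 * (1 + \<epsilon>)) * real d \<le> 3 / 2 * \<epsilon> * real d"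
          using \<epsilon> by (intro mult_right_mono) (auto simp: field_simps)
        moreover have "0 \<le> 3 * \<epsilon> / (2 * (1 + \<epsilon>)) * real d" using \<epsilon> by simp
        ultimately show "real s \<le> 3 / 2 * \<epsilon> * real d + 1" unfolding s_def by linarith
      qed (use \<epsilon> in simp)
      finally have "ln (real n) \<le> 3 * \<epsilon> * real d * ln (60 / \<epsilon>)"
        using elim by (simp add: algebra_simps)
      also have "\<dots> \<le> 3 * \<epsilon> * real d * ((1 + ln 60) * M)"
      proof (intro mult_left_mono)
        have "ln (60 / \<epsilon>) = ln 60 + ln (1 / \<epsilon>)" using \<epsilon> by (simp add: ln_div)
        also have "\<dots> \<le> ln 60 * M + M" using M by (intro add_mono) auto
        finally show "ln (60 / \<epsilon>) \<le> (1 + ln 60) * M" by (simp add: algebra_simps)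
      qed (use \<epsilon> in simp)
      finally have main: "ln (real n) \<le> 3 * \<epsilon> * real d * ((1 + ln 60) * M)" .
      have "0 < 3 * (1 + ln 60) * (\<epsilon> * M)" using \<epsilon> M by (simp add: add_pos_pos)
      then have "ln (real n) / (3 * (1 + ln 60) * (\<epsilon> * M)) \<le> real d"
        using main by (subst pos_divide_le_eq) (auto simp: mult_ac)
      then show "1 / (3 * (1 + ln 60)) * ln (real n) / (\<epsilon> * max 1 (ln (1 / \<epsilon>))) \<le> real d"
        by (simp add: M_def)
    qed
  qed
qed

end
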